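(* Let $\mathcal T$ be the class of languages of standard session types and $\mathcal R$ the class of languages of session types with responses, i.e. $\mathcal T=\{\mathsf{str}(T)\mid T \text{ a standard session type}\}$ and $\mathcal R=\{\mathsf{str}_R(T)\mid T\text{ a session type with responses}\}$. Then session types with responses are strictly more expressive than standard session types: $\mathcal T\subsetneq\mathcal R$.
   Context: **Types.** Let $\mathcal L$ be a countably infinite set of labels; $l$ ranges over $\mathcal L$ and $L$ over subsets of $\mathcal L$. Session types with responses are given by $$S,T ::= \&\{l_i[L_i].T_i\}_{i\in I}\mid \oplus\{l_i[L_i].T_i\}_{i\in I}\mid\ !.T\mid\ ?.T\mid \mu t.T\mid t\mid \mathtt{end},$$ with $I$ finite and the labels $l_i$ in each branch ($\&$) or select ($\oplus$) distinct. Types are closed and contractive, and are taken equi-recursively: a type is identified with its (possibly infinite) tree unfolding. A type is a *standard* session type if every response set $L$ occurring in it is $\emptyset$. **Transitions of types.** Labels $\rho ::=\ !\mid\ ?\mid \&l[L]\mid\oplus l[L]$, and $!.T\xrightarrow{!}T$; $?.T\xrightarrow{?}T$; $\&\{l_i[L_i].T_i\}_{i\in I}\xrightarrow{\&l_i[L_i]}T_i$ and $\oplus\{l_i[L_i].T_i\}_{i\in I}\xrightarrow{\oplus l_i[L_i]}T_i$ for $i\in I$. **Responses.** $\mathsf{res}(!)=\mathsf{res}(?)=\emptyset$, $\mathsf{res}(\&l[L])=\mathsf{res}(\oplus l[L])=\{l\}$; $\mathsf{req}(!)=\mathsf{req}(?)=\emptyset$, $\mathsf{req}(\&l[L])=\mathsf{req}(\oplus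 l[L])=L$. For a finite or infinite sequence $\alpha$ of labels, $\mathsf{res}(\alpha)=\bigcup\{\mathsf{res}(\rho)\mid \rho\text{ occurs in }\alpha\}$. The sequence $\alpha$ is *live* iff whenever $\alpha=\varphi\,\rho\,\beta$ (with $\varphi$ finite, $\rho$ a single label), $\mathsf{req}(\rho)\subseteq\mathsf{res}(\beta)$. **Traces.** A transition sequence of $T$ is a finite sequence $T=T_1\xrightarrow{\rho_1}\cdots\xrightarrow{\rho_{n-1}}T_n$ ($n\ge 1$, not necessarily maximal) or an infinite sequence $T=T_1\xrightarrow{\rho_1}T_2\xrightarrow{\rho_2}\cdots$. $\mathsf{tr}(T)$ is the set of label sequences $\rho_1\rho_2\cdots$ of transition sequences of $T$, and $\mathsf{tr}_R(T)=\{\alpha\in\mathsf{tr}(T)\mid\alpha\text{ live}\}$. Put $\mathsf{sel}(!)=\mathsf{sel}(?)=\varepsilon$ (empty sequence), $\mathsf{sel}(\&l[L])=\mathsf{sel}(\oplus l[L])=l$, lifted pointwise (with concatenation) to finite and infinite sequences. Then $\mathsf{str}(T)=\{\mathsf{sel}(\alpha)\mid\alpha\in\mathsf{tr}(T)\}$ and $\mathsf{str}_R(T)=\{\mathsf{sel}(\alpha)\mid\alpha\in\mathsf{tr}_R(T)\}$. *)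

theory Defs
  imports
    "HOL-Library.Finite_Map"
    "HOL-Library.Stream"
    "HOL-Library.Countable"
    "HOL-Library.Infinite_Typeclass"
begin

section \<open>Finite and infinite sequences\<close>

datatype (set_seq: 'a) seq = Fin "'a list" | Inf "'a stream"

fun prepend :: "'a list \<Rightarrow> 'a seq \<Rightarrow> 'a seq" where
  "prepend xs (Fin ys) = Fin (xs @ ys)"
| "prepend xs (Inf s) = Inf (xs @- s)"

text \<open>
  Concatenation of an infinite sequence of finite words. The result is a finite word
  if only finitely many of the words are nonempty; otherwise the empty words have to be dropped
  before applying \<^const>\<open>flat\<close>, which is only meaningful on nonempty words.
\<close>
definition concat_stream :: "'a list stream \<Rightarrow> 'a seq" where
  "concat_stream ws =
     (if finite {i. ws !! i \<noteq> []}
      then Fin (concat (stake (LEAST n. \<forall>i\<ge>n. ws !! i = []) ws))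
      else Inf (flat (sfilter (\<lambda>w. w \<noteq> []) ws)))"

fun concat_map_seq :: "('a \<Rightarrow> 'b list) \<Rightarrow> 'a seq \<Rightarrow> 'b seq" where
  "concat_map_seq f (Fin xs) = Fin (concat (map f xs))"
| "concat_map_seq f (Inf s) = concat_stream (smap f s)"


section \<open>Session types with responses\<close>

type_synonym tvar = nat

text \<open>
  A family of branches \<open>{l\<^sub>i[L\<^sub>i].T\<^sub>i}\<close> with finite index set and distinct labels is a finite map
  taking each \<open>l\<^sub>i\<close> to the pair \<open>(L\<^sub>i, T\<^sub>i)\<close>.
\<close>
datatype 'l stype =
    Branch "('l, 'l set \<times> 'l stype) fmap"
  | Select "('l, 'l set \<times> 'l stype) fmap"
  | Send "'l stype"
  | Recv "'l stype"
  | Mu tvar "'l stype"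
  | Var tvar
  | End

primrec free_vars :: "'l stype \<Rightarrow> tvar set" where
  "free_vars (Branch m) = \<Union> (snd ` fmran' (fmmap (map_prod id free_vars) m))"
| "free_vars (Select m) = \<Union> (snd ` fmran' (fmmap (map_prod id free_vars) m))"
| "free_vars (Send T) = free_vars T"
| "free_vars (Recv T) = free_vars T"
| "free_vars (Mu t T) = free_vars T - {t}"
| "free_vars (Var t) = {t}"
| "free_vars End = {}"

definition closed_type :: "'l stype \<Rightarrow> bool" where
  "closed_type T \<longleftrightarrow> free_vars T = {}"

text \<open>
  The free variables that occur under nothing but \<^const>\<open>Mu\<close> binders.
  A type is contractive if no subterm \<open>\<mu>t.T\<close> has \<open>t\<close> unguarded in \<open>T\<close>, that is,
  no subterm has the form \<open>\<mu>t.\<mu>t\<^sub>1 \<dots> \<mu>t\<^sub>n.t\<close>.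
\<close>
primrec unguarded_vars :: "'l stype \<Rightarrow> tvar set" where
  "unguarded_vars (Branch m) = {}"
| "unguarded_vars (Select m) = {}"
| "unguarded_vars (Send T) = {}"
| "unguarded_vars (Recv T) = {}"
| "unguarded_vars (Mu t T) = unguarded_vars T - {t}"
| "unguarded_vars (Var t) = {t}"
| "unguarded_vars End = {}"

primrec contractive :: "'l stype \<Rightarrow> bool" where
  "contractive (Branch m) \<longleftrightarrow> (\<forall>p \<in> fmran' (fmmap (map_prod id contractive) m). snd p)"
| "contractive (Select m) \<longleftrightarrow> (\<forall>p \<in> fmran' (fmmap (map_prod id contractive) m). snd p)"
| "contractive (Send T) \<longleftrightarrow> contractive T"
| "contractive (Recv T) \<longleftrightarrow> contractive T"
| "contractive (Mu t T) \<longleftrightarrow> t \<notin> unguarded_vars T \<and> contractive T"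
| "contractive (Var t) \<longleftrightarrow> True"
| "contractive End \<longleftrightarrow> True"

definition session_type :: "'l stype \<Rightarrow> bool" where
  "session_type T \<longleftrightarrow> closed_type T \<and> contractive T"

primrec response_sets :: "'l stype \<Rightarrow> 'l set set" where
  "response_sets (Branch m) =
     fst ` fmran' m \<union> \<Union> (snd ` fmran' (fmmap (map_prod id response_sets) m))"
| "response_sets (Select m) =
     fst ` fmran' m \<union> \<Union> (snd ` fmran' (fmmap (map_prod id response_sets) m))"
| "response_sets (Send T) = response_sets T"
| "response_sets (Recv T) = response_sets T"
| "response_sets (Mu t T) = response_sets T"
| "response_sets (Var t) = {}"
| "response_sets End = {}"

definition standard_type :: "'l stype \<Rightarrow> bool" where
  "standard_type T \<longleftrightarrow> session_type T \<and> (\<forall>L \<in> response_sets T. L = {})"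

text \<open>
  Substitution of \<open>U\<close> for the free occurrences of \<open>t\<close>. It does not rename binders, so it
  is only meaningful for closed \<open>U\<close>; it is used below only to unfold a recursive type, which is closed.
\<close>
primrec subst :: "tvar \<Rightarrow> 'l stype \<Rightarrow> 'l stype \<Rightarrow> 'l stype" where
  "subst t U (Branch m) = Branch (fmmap (map_prod id (subst t U)) m)"
| "subst t U (Select m) = Select (fmmap (map_prod id (subst t U)) m)"
| "subst t U (Send T) = Send (subst t U T)"
| "subst t U (Recv T) = Recv (subst t U T)"
| "subst t U (Mu s T) = (if s = t then Mu s T else Mu s (subst t U T))"
| "subst t U (Var s) = (if s = t then U else Var s)"
| "subst t U End = End"


section \<open>Transitions\<close>

datatype 'l action = ASend | ARecv | ABranch 'l "'l set" | ASelect 'l "'l set"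

text \<open>
  The rule \<open>unfold\<close> renders the equi-recursive reading: \<open>\<mu>t.T\<close> and its unfolding
  have the same tree and hence the same transitions.
\<close>
inductive step :: "'l stype \<Rightarrow> 'l action \<Rightarrow> 'l stype \<Rightarrow> bool" where
  send: "step (Send T) ASend T"
| recv: "step (Recv T) ARecv T"
| branch: "fmlookup m l = Some (L, T) \<Longrightarrow> step (Branch m) (ABranch l L) T"
| select: "fmlookup m l = Some (L, T) \<Longrightarrow> step (Select m) (ASelect l L) T"
| unfold: "step (subst t (Mu t T) T) \<rho> T' \<Longrightarrow> step (Mu t T) \<rho> T'"

fun res :: "'l action \<Rightarrow> 'l set" where
  "res ASend = {}"
| "res ARecv = {}"
| "res (ABranch l L) = {l}"
| "res (ASelect l L) = {l}"

fun req :: "'l action \<Rightarrow> 'l set" where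
  "req ASend = {}"
| "req ARecv = {}"
| "req (ABranch l L) = L"
| "req (ASelect l L) = L"

fun sel :: "'l action \<Rightarrow> 'l list" where
  "sel ASend = []"
| "sel ARecv = []"
| "sel (ABranch l L) = [l]"
| "sel (ASelect l L) = [l]"

definition res_seq :: "'l action seq \<Rightarrow> 'l set" where
  "res_seq \<alpha> = (\<Union>\<rho> \<in> set_seq \<alpha>. res \<rho>)"

definition live :: "'l action seq \<Rightarrow> bool" where
  "live \<alpha> \<longleftrightarrow> (\<forall>\<phi> \<rho> \<beta>. \<alpha> = prepend \<phi> (prepend [\<rho>] \<beta>) \<longrightarrow> req \<rho> \<subseteq> res_seq \<beta>)"


section \<open>Traces and languages\<close>

definition tr :: "'l stype \<Rightarrow> 'l action seq set" where
  "tr T =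
     {Fin \<rho>s | \<rho>s. \<exists>Ts. Ts 0 = T \<and> (\<forall>i < length \<rho>s. step (Ts i) (\<rho>s ! i) (Ts (Suc i)))} \<union>
     {Inf \<rho>s | \<rho>s. \<exists>Ts. Ts 0 = T \<and> (\<forall>i. step (Ts i) (\<rho>s !! i) (Ts (Suc i)))}"

definition tr_R :: "'l stype \<Rightarrow> 'l action seq set" where
  "tr_R T = {\<alpha> \<in> tr T. live \<alpha>}"

definition str :: "'l stype \<Rightarrow> 'l seq set" where
  "str T = concat_map_seq sel ` tr T"

definition str_R :: "'l stype \<Rightarrow> 'l seq set" where
  "str_R T = concat_map_seq sel ` tr_R T"

definition standard_languages :: "'l seq set set" where
  "standard_languages = {str T | T. standard_type T}"

definition response_languages :: "'l seq set set" where
  "response_languages = {str_R T | T. session_type T}"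

end

theory Submission
  imports Defs
begin

text \<open>
  Every sequence of labels without response sets is live, so a standard type has the same language
  under both readings. Languages of standard types are closed under finite prefixes, because
  initial segments of transition sequences are transition sequences and each action contributes
  at most one label. With responses this fails: in \<open>&{a[{a}].&{a[{}].end}}\<close> the first \<open>a\<close> has to be
  answered by a second one, so \<open>a a\<close> belongs to the language and \<open>a\<close> does not.
\<close>

section \<open>Response sets along transitions\<close>

lemma response_sets_fmap:
  "response_sets (Branch m) = (\<Union>(L, T) \<in> fmran' m. insert L (response_sets T))"
  "response_sets (Select m) = (\<Union>(L, T) \<in> fmran' m. insert L (response_sets T))"
  by (auto simp: case_prod_beta)

lemma response_sets_subst:
  "response_sets (subst t U T) \<subseteq> response_sets T \<union> response_sets U"
proof (induction T)
  case (Branch m)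
  \<comment> \<open>Substitution leaves the response set of a branch unchanged and alters only its
    continuation, so each branch is bounded in the shape of the summands in
    \<open>response_sets_fmap\<close>.\<close>
  have "insert (fst p) (response_sets (subst t U (snd p))) \<subseteq> response_sets (Branch m) \<union> response_sets U"
    if "p \<in> fmran' m" for p
  proof -
    obtain L T where p: "p = (L, T)"
      by fastforce
    have "response_sets (subst t U T) \<subseteq> response_sets T \<union> response_sets U"
      using Branch[OF that] p by simp
    then show ?thesis
      using that p unfolding response_sets_fmap by auto
  qed
  then show ?case
    by (simp add: response_sets_fmap UN_subset_iff split_beta del: response_sets.simps(1))
next
  case (Select m)
  have "insert (fst p) (response_sets (subst t U (snd p))) \<subseteq> response_sets (Select m) \<union> response_sets U"
    if "p \<in> fmran' m" for p
  proof -
    obtain L T where p: "p = (L, T)"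
      by fastforce
    have "response_sets (subst t U T) \<subseteq> response_sets T \<union> response_sets U"
      using Select[OF that] p by simp
    then show ?thesis
      using that p unfolding response_sets_fmap by auto
  qed
  then show ?case
    by (simp add: response_sets_fmap UN_subset_iff split_beta del: response_sets.simps(2))
qed auto

text \<open>Continuations are subterms, except under \<open>unfold\<close>; there the substituted
  type is \<open>Mu t T\<close>, which has the response sets of \<open>T\<close>, so substitution
  adds nothing new. The extra \<open>{}\<close> on the right accounts for \<open>ASend\<close> and
  \<open>ARecv\<close>, whose empty request need not occur in the type.\<close>

lemma step_response_sets:
  assumes "step T \<rho> T'"
  shows "insert (req \<rho>) (response_sets T') \<subseteq> insert {} (response_sets T)"
  using assms
proof induction
  case (unfold t T \<rho> T')
  then show ?case
    using response_sets_subst[of t "Mu t T" T] by auto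
next
  case (branch m l L T)
  then have "(L, T) \<in> fmran' m"
    by (rule fmran'I)
  then show ?case
    by (auto simp: response_sets_fmap simp del: response_sets.simps(1))
next
  case (select m l L T)
  then have "(L, T) \<in> fmran' m"
    by (rule fmran'I)
  then show ?case
    by (auto simp: response_sets_fmap simp del: response_sets.simps(2))
qed auto

lemma req_eq_empty_if_tr:
  assumes "\<alpha> \<in> tr T" "response_sets T \<subseteq> {{}}" "\<rho> \<in> set_seq \<alpha>"
  shows "req \<rho> = {}"
proof -
  \<comment> \<open>The labels are given by an arbitrary function \<open>r\<close>, so that one
    induction along the run serves lists and streams. Steps are assumed only up to \<open>i\<close>,
    as a finite run guarantees none beyond its length.\<close>
  have *: "req (r i) = {}"
    if Ts: "Ts 0 = T" "\<And>j. j \<le> i \<Longrightarrow> step (Ts j) (r j) (Ts (Suc j))" for Ts r i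
  proof -
    have "j \<le> i \<Longrightarrow> response_sets (Ts j) \<subseteq> {{}}" for j
    proof (induction j)
      case (Suc j)
      then show ?case
        using step_response_sets[OF Ts(2)[of j]] by auto
    qed (use assms(2) Ts(1) in auto)
    then show ?thesis
      using step_response_sets[OF Ts(2)[of i]] by auto
  qed
  from assms(1) consider
    (fin) \<rho>s Ts where "\<alpha> = Fin \<rho>s" "Ts 0 = T" "\<forall>i < length \<rho>s. step (Ts i) (\<rho>s ! i) (Ts (Suc i))"
  | (inf) \<rho>s Ts where "\<alpha> = Inf \<rho>s" "Ts 0 = T" "\<forall>i. step (Ts i) (\<rho>s !! i) (Ts (Suc i))"
    unfolding tr_def by blast
  then show ?thesis
  proof cases
    case fin
    with assms(3) obtain i where "i < length \<rho>s" "\<rho> = \<rho>s ! i"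
      by (auto simp: in_set_conv_nth)
    with fin show ?thesis
      using *[of Ts i "(!) \<rho>s"] by auto
  next
    case inf
    with assms(3) obtain i where "\<rho> = \<rho>s !! i"
      by (auto simp: sset_range)
    with inf show ?thesis
      using *[of Ts i "(!!) \<rho>s"] by auto
  qed
qed

text \<open>Places the action singled out by a decomposition in \<open>live\<close> among the
  elements of the sequence, where \<open>req_eq_empty_if_tr\<close> applies.\<close>

lemma set_seq_prepend [simp]: "set_seq (prepend xs \<alpha>) = set xs \<union> set_seq \<alpha>"
  by (cases \<alpha>) auto

lemma str_R_eq_str_if_standard:
  assumes "standard_type T"
  shows "str_R T = str T"
proof -
  have "tr_R T = tr T"
    using assms req_eq_empty_if_tr[of _ T]
    by (fastforce simp: tr_R_def live_def standard_type_def)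
  then show ?thesis
    by (simp add: str_R_def str_def)
qed

section \<open>Prefix closure of traces and of standard languages\<close>

lemma tr_prefix:
  assumes "prepend \<phi> \<beta> \<in> tr T"
  shows "Fin \<phi> \<in> tr T"
proof (cases \<beta>)
  case (Fin ys)
  with assms obtain Ts where
    "Ts 0 = T" "\<And>i. i < length (\<phi> @ ys) \<Longrightarrow> step (Ts i) ((\<phi> @ ys) ! i) (Ts (Suc i))"
    by (auto simp: tr_def)
  then have "\<forall>i < length \<phi>. step (Ts i) (\<phi> ! i) (Ts (Suc i))"
    by (metis length_append nth_append trans_less_add1)
  with \<open>Ts 0 = T\<close> show ?thesis
    by (auto simp: tr_def)
next
  case (Inf s)
  with assms obtain Ts where "Ts 0 = T" "\<And>i. step (Ts i) ((\<phi> @- s) !! i) (Ts (Suc i))"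
    by (auto simp: tr_def)
  then have "\<forall>i < length \<phi>. step (Ts i) (\<phi> ! i) (Ts (Suc i))"
    by (metis shift_snth_less)
  with \<open>Ts 0 = T\<close> show ?thesis
    by (auto simp: tr_def)
qed

text \<open>Since \<open>sel\<close> yields at most one label per action, no cut of the word falls
  inside the contribution of an action, and so every cut lifts to the action sequence.\<close>

lemma concat_map_sel_prefix:
  assumes "concat (map sel \<rho>s) = u @ v"
  obtains \<phi> \<psi> where "\<rho>s = \<phi> @ \<psi>" "concat (map sel \<phi>) = u"
  using assms
proof (induction \<rho>s arbitrary: u thesis)
  case Nil
  then show ?case by auto
next
  case (Cons \<rho> \<rho>s)
  show ?case
  proof (cases "u = []")
    case True
    then show ?thesis
      using Cons.prems(1)[of "[]" "\<rho> # \<rho>s"] by simp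
  next
    case False
    with Cons.prems(2) obtain u' where u': "u = sel \<rho> @ u'" "concat (map sel \<rho>s) = u' @ v"
      by (cases \<rho>; cases u) auto
    from Cons.IH[OF _ u'(2)] obtain \<phi> \<psi> where "\<rho>s = \<phi> @ \<psi>" "concat (map sel \<phi>) = u'"
      by blast
    then show ?thesis
      using Cons.prems(1)[of "\<rho> # \<phi>" \<psi>] u'(1) by simp
  qed
qed

lemma str_prefix:
  assumes "Fin (u @ v) \<in> str T"
  shows "Fin u \<in> str T"
proof -
  from assms obtain \<alpha> where \<alpha>: "\<alpha> \<in> tr T" "concat_map_seq sel \<alpha> = Fin (u @ v)"
    by (auto simp: str_def)
  \<comment> \<open>A finite word may stem from an infinite run that selects only finitely many
    labels. By \<open>concat_stream\<close> the word is then already produced by an initial segment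
    of that run, so a finite trace can be used in either case.\<close>
  obtain \<rho>s where \<rho>s: "Fin \<rho>s \<in> tr T" "concat (map sel \<rho>s) = u @ v"
  proof (cases \<alpha>)
    case (Fin xs)
    with \<alpha> that show ?thesis by auto
  next
    case (Inf s)
    with \<alpha>(2) obtain n where "concat (stake n (smap sel s)) = u @ v"
      by (auto simp: concat_stream_def split: if_splits)
    moreover have "Fin (stake n s) \<in> tr T"
      using \<alpha>(1) Inf tr_prefix[of "stake n s" "Inf (sdrop n s)"] by (simp add: stake_sdrop)
    ultimately show ?thesis
      using that by simp
  qed
  then obtain \<phi> \<psi> where \<phi>: "\<rho>s = \<phi> @ \<psi>" "concat (map sel \<phi>) = u"
    using concat_map_sel_prefix by blast
  then have "Fin \<phi> \<in> tr T"
    using \<rho>s(1) tr_prefix[of \<phi> "Fin \<psi>"] by simp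
  with \<phi>(2) show ?thesis
    by (force simp: str_def)
qed

section \<open>The separating type and its language\<close>

definition branch1 :: "'l \<Rightarrow> 'l set \<Rightarrow> 'l stype \<Rightarrow> 'l stype" where
  "branch1 l L T = Branch (fmupd l (L, T) fmempty)"

inductive_cases step_BranchE: "step (Branch m) \<rho> T"
inductive_cases step_EndE: "step End \<rho> T"

lemma session_type_branch1 [simp]: "session_type (branch1 l L T) \<longleftrightarrow> session_type T"
proof -
  have "fmran' (fmupd l (L, T) fmempty) = {(L, T)}"
    by (auto simp: fmlookup_ran'_iff split: if_splits)
  then show ?thesis
    by (simp add: branch1_def session_type_def closed_type_def)
qed

lemma session_type_End [simp]: "session_type End"
  by (simp add: session_type_def closed_type_def)

lemma step_branch1_iff [simp]: "step (branch1 l L T) \<rho> T' \<longleftrightarrow> \<rho> = ABranch l L \<and> T' = T"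
  by (auto simp: branch1_def elim: step_BranchE intro: step.branch split: if_splits)

lemma step_End_iff [simp]: "\<not> step End \<rho> T"
  by (blast elim: step_EndE)

lemma Nil_in_tr: "Fin [] \<in> tr T"
  by (auto simp: tr_def)

lemma Fin_Cons_in_tr_iff: "Fin (\<rho> # \<rho>s) \<in> tr T \<longleftrightarrow> (\<exists>T'. step T \<rho> T' \<and> Fin \<rho>s \<in> tr T')"
proof
  assume "Fin (\<rho> # \<rho>s) \<in> tr T"
  then obtain Ts where Ts: "Ts 0 = T"
    "\<And>i. i < Suc (length \<rho>s) \<Longrightarrow> step (Ts i) ((\<rho> # \<rho>s) ! i) (Ts (Suc i))"
    by (auto simp: tr_def)
  have "Fin \<rho>s \<in> tr (Ts 1)"
    using Ts(2)[of "Suc _"] by (auto simp: tr_def intro!: exI[of _ "\<lambda>i. Ts (Suc i)"])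
  then show "\<exists>T'. step T \<rho> T' \<and> Fin \<rho>s \<in> tr T'"
    using Ts(1) Ts(2)[of 0] by auto
next
  assume "\<exists>T'. step T \<rho> T' \<and> Fin \<rho>s \<in> tr T'"
  then obtain Ts where "step T \<rho> (Ts 0)" "\<forall>i < length \<rho>s. step (Ts i) (\<rho>s ! i) (Ts (Suc i))"
    by (auto simp: tr_def)
  then show "Fin (\<rho> # \<rho>s) \<in> tr T"
    \<comment> \<open>The witness \<open>case_nat T Ts\<close> puts \<open>T\<close> in front of the
      run \<open>Ts\<close>, shifting its indices by one.\<close>
    by (auto simp: tr_def nth_Cons split: nat.splits intro!: exI[of _ "case_nat T Ts"])
qed

lemma Inf_SCons_in_tr_iff: "Inf (\<rho> ## s) \<in> tr T \<longleftrightarrow> (\<exists>T'. step T \<rho> T' \<and> Inf s \<in> tr T')"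
proof
  assume "Inf (\<rho> ## s) \<in> tr T"
  then obtain Ts where Ts: "Ts 0 = T" "\<And>i. step (Ts i) ((\<rho> ## s) !! i) (Ts (Suc i))"
    by (auto simp: tr_def)
  have "Inf s \<in> tr (Ts 1)"
    using Ts(2)[of "Suc _"] by (auto simp: tr_def intro!: exI[of _ "\<lambda>i. Ts (Suc i)"])
  then show "\<exists>T'. step T \<rho> T' \<and> Inf s \<in> tr T'"
    using Ts(1) Ts(2)[of 0] by auto
next
  assume "\<exists>T'. step T \<rho> T' \<and> Inf s \<in> tr T'"
  then obtain Ts where Ts: "step T \<rho> (Ts 0)" "\<And>i. step (Ts i) (s !! i) (Ts (Suc i))"
    by (auto simp: tr_def)
  have "step (case_nat T Ts i) ((\<rho> ## s) !! i) (case_nat T Ts (Suc i))" for i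
    using Ts by (cases i) auto
  then show "Inf (\<rho> ## s) \<in> tr T"
    by (auto simp: tr_def intro!: exI[of _ "case_nat T Ts"])
qed

lemma tr_End: "tr End = {Fin []}"
proof -
  have "\<alpha> = Fin []" if "\<alpha> \<in> tr End" for \<alpha> :: "'l action seq"
  proof (cases \<alpha>)
    case (Fin xs)
    with that show ?thesis
      by (cases xs) (auto simp: Fin_Cons_in_tr_iff)
  next
    case (Inf s)
    with that show ?thesis
      by (cases s) (auto simp: Inf_SCons_in_tr_iff)
  qed
  then show ?thesis
    using Nil_in_tr by blast
qed

text \<open>Transition sequences need not be maximal, hence the additional \<open>Fin []\<close>.
  With \<open>tr_End\<close> this computes the traces of nested single branches by
  rewriting.\<close>

lemma tr_branch1: "tr (branch1 l L T) = insert (Fin []) (prepend [ABranch l L] ` tr T)"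
proof (intro equalityI subsetI)
  fix \<alpha> assume \<alpha>: "\<alpha> \<in> tr (branch1 l L T)"
  show "\<alpha> \<in> insert (Fin []) (prepend [ABranch l L] ` tr T)"
  proof (cases \<alpha>)
    case (Fin xs)
    with \<alpha> show ?thesis
      by (cases xs) (auto simp: Fin_Cons_in_tr_iff intro: image_eqI[of _ _ "Fin _"])
  next
    case (Inf s)
    with \<alpha> show ?thesis
      by (cases s) (auto simp: Inf_SCons_in_tr_iff intro: image_eqI[of _ _ "Inf _"])
  qed
next
  fix \<alpha> assume "\<alpha> \<in> insert (Fin []) (prepend [ABranch l L] ` tr T)"
  then consider "\<alpha> = Fin []" | \<beta> where "\<beta> \<in> tr T" "\<alpha> = prepend [ABranch l L] \<beta>"
    by blast
  then show "\<alpha> \<in> tr (branch1 l L T)"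
  proof cases
    case 2
    then show ?thesis
      by (cases \<beta>) (auto simp: Fin_Cons_in_tr_iff Inf_SCons_in_tr_iff)
  qed (simp add: Nil_in_tr)
qed

text \<open>Only a finite \<beta> can complete a decomposition of a finite sequence.\<close>

lemma live_Fin_iff:
  "live (Fin \<rho>s) \<longleftrightarrow> (\<forall>\<phi> \<rho> \<psi>. \<rho>s = \<phi> @ \<rho> # \<psi> \<longrightarrow> req \<rho> \<subseteq> \<Union> (res ` set \<psi>))"
proof -
  have *: "Fin \<rho>s = prepend \<phi> (prepend [\<rho>] \<beta>) \<longleftrightarrow> (\<exists>\<psi>. \<beta> = Fin \<psi> \<and> \<rho>s = \<phi> @ \<rho> # \<psi>)"
    for \<phi> \<rho> \<beta>
    by (cases \<beta>) auto
  show ?thesis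
    unfolding live_def * res_seq_def by (metis seq.set(1))
qed

lemma live_Fin_Nil [simp]: "live (Fin [])"
  by (simp add: live_Fin_iff)

text \<open>A decomposition singles out either the head or an action of the tail; this recursion
  lets the simplifier decide liveness of explicit lists.\<close>

lemma live_Fin_Cons [simp]:
  "live (Fin (\<rho> # \<rho>s)) \<longleftrightarrow> req \<rho> \<subseteq> \<Union> (res ` set \<rho>s) \<and> live (Fin \<rho>s)"
  unfolding live_Fin_iff Cons_eq_append_conv by blast

text \<open>Of the three traces, only the one of length one is not live: responses are sought
  strictly after the requesting action, so the first \<open>a\<close> does not answer
  itself.\<close>

lemma str_R_self_response:
  "str_R (branch1 a {a} (branch1 a {} End)) = {Fin [], Fin [a, a]}"
proof -
  have "tr_R (branch1 a {a} (branch1 a {} End)) = {Fin [], Fin [ABranch a {a}, ABranch a {}]}"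
    by (auto simp: tr_R_def tr_branch1 tr_End)
  then show ?thesis
    by (simp add: str_R_def)
qed

theorem theorem3p10:
  shows "(standard_languages :: ('l :: {countable, infinite}) seq set set) \<subset> response_languages"
proof
  show "(standard_languages :: 'l seq set set) \<subseteq> response_languages"
    using str_R_eq_str_if_standard
    by (fastforce simp: standard_languages_def response_languages_def standard_type_def)
  fix a :: 'l
  let ?R = "branch1 a {a} (branch1 a {} End)"
  have "str_R ?R \<in> response_languages"
    by (auto simp: response_languages_def)
  moreover have "str_R ?R \<notin> standard_languages"
  proof
    assume "str_R ?R \<in> standard_languages"
    then obtain T where "str T = {Fin [], Fin [a, a]}"
      by (auto simp: standard_languages_def str_R_self_response)
    then show False
      using str_prefix[of "[a]" "[a]" T] by simp
  qed
  ultimately show "standard_languages \<noteq> (response_languages :: 'l seq set set)"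
    by blast
qed

end
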